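(* For each $n\in\mathbb{N}\cup\{\infty\}$, the cube $[0,1]^n$ is $CT_4$.
   Context: Here $[0,1]^n$ carries the product topology and $[0,1]^\infty$ is the product of countably infinitely many copies of $[0,1]$; $\mathbb{N}=\{1,2,\dots\}$. For a space $X$, $\mathrm{Cld}(X)$ denotes the set of all non-empty closed subsets of $X$, endowed with the Vietoris topology, i.e. the topology having as a subbase all sets $U^-=\{F\in\mathrm{Cld}(X): F\cap U\neq\emptyset\}$ and $U^+=\{F\in\mathrm{Cld}(X): F\subseteq U\}$ with $U$ open in $X$. Let $\mathcal{T}_4(X)=\{(F_1,F_2)\in\mathrm{Cld}(X)^2: F_1\cap F_2=\emptyset\}$, with the subspace topology from the product space $\mathrm{Cld}(X)^2$. The space $X$ is called $CT_4$ if there is a continuous map $\phi=(\phi_1,\phi_2):\mathcal{T}_4(X)\to\mathrm{Cld}(X)^2$ such that for every $(F_1,F_2)\in\mathcal{T}_4(X)$: $\phi_1(F_1,F_2)\cup\phi_2(F_1,F_2)=X$ and $F_j\cap\phi_j(F_1,F_2)=\emptyset$ for $j=1,2$. *)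

theory Defs
  imports "HOL-Analysis.Analysis"
begin

definition Cld :: "'a topology \<Rightarrow> 'a set set" where
  "Cld X = {F. closedin X F \<and> F \<noteq> {}}"

definition vietoris :: "'a topology \<Rightarrow> 'a set topology" where
  "vietoris X = topology_generated_by
     ({{F \<in> Cld X. F \<inter> U \<noteq> {}} | U. openin X U} \<union>
      {{F \<in> Cld X. F \<subseteq> U} | U. openin X U})"

lemma topspace_vietoris [simp]: "topspace (vietoris X) = Cld X"
proof -
  have "{F \<in> Cld X. F \<subseteq> topspace X} = Cld X"
    by (auto simp: Cld_def dest: closedin_subset)
  then show ?thesis
    unfolding vietoris_def topology_generated_by_topspace by blast
qed

definition T4_pairs :: "'a topology \<Rightarrow> ('a set \<times> 'a set) set" where
  "T4_pairs X = {(F1, F2). F1 \<in> Cld X \<and> F2 \<in> Cld X \<and> F1 \<inter> F2 = {}}"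

definition CT4 :: "'a topology \<Rightarrow> bool" where
  "CT4 X \<longleftrightarrow> (\<exists>\<phi>.
     continuous_map
       (subtopology (prod_topology (vietoris X) (vietoris X)) (T4_pairs X))
       (prod_topology (vietoris X) (vietoris X)) \<phi> \<and>
     (\<forall>(F1, F2) \<in> T4_pairs X.
        fst (\<phi> (F1, F2)) \<union> snd (\<phi> (F1, F2)) = topspace X \<and>
        F1 \<inter> fst (\<phi> (F1, F2)) = {} \<and>
        F2 \<inter> snd (\<phi> (F1, F2)) = {}))"

text \<open>Coordinates are indexed from 0, so that \<open>n = \<infinity>\<close> yields all of \<open>nat\<close> as the
  index set. Points of the product are functions that are \<open>undefined\<close> off the index set.\<close>

definition cube :: "enat \<Rightarrow> (nat \<Rightarrow> real) topology" where
  "cube n = product_topology (\<lambda>_. top_of_set {0..1}) {i. enat i < n}"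

end

theory Submission imports Defs begin

text \<open>
  On a compact convex subset of a Hilbert space, send a pair of disjoint closed sets
  \<open>F1\<close>, \<open>F2\<close> to the two closed halves cut out by their bisector: \<open>\<phi>\<^sub>1\<close> consists of the
  points at least as close to \<open>F2\<close> as to \<open>F1\<close>, and \<open>\<phi>\<^sub>2\<close> of the points at least as close
  to \<open>F1\<close> as to \<open>F2\<close>. The cover and disjointness conditions are immediate; the point is
  continuity.

  The distance from \<open>x\<close> to \<open>A\<close> is jointly continuous in \<open>x\<close> and \<open>A\<close>
  (\<open>gap_continuous\<close>). That a half is contained in an open set \<open>U\<close> is then an open
  condition by compactness of the complement of \<open>U\<close> (tube lemma). That a half meets an
  open set \<open>U\<close> is an open condition because, in the presence of strict convexity, it is
  equivalent to \<open>U\<close> containing a point strictly closer to \<open>A\<close> than to \<open>B\<close>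
  (\<open>near_hits_open_iff\<close>): if \<open>x\<close> is as close to \<open>A\<close> as to \<open>B\<close>, a small step from \<open>x\<close>
  towards its nearest point in \<open>A\<close> breaks the tie.

  The cube, finite- or infinite-dimensional, carries the squared Hilbert distance
  \<open>\<Sum>i. 2\<^sup>-\<^sup>i (x i - y i)\<^sup>2\<close>, which is continuous for the product topology. The tie-breaking
  step rests on the fact that the difference of the squared distances from \<open>y\<close> to two
  fixed points is an affine function of \<open>y\<close> (\<open>cube_sqdist_affine\<close>).
\<close>

section \<open>Continuity into the Vietoris topology\<close>

lemma vietoris_hit_open: "openin X U \<Longrightarrow> openin (vietoris X) {F \<in> Cld X. F \<inter> U \<noteq> {}}"
  unfolding vietoris_def by (rule topology_generated_by_Basis) blast

lemma vietoris_inside_open: "openin X U \<Longrightarrow> openin (vietoris X) {F \<in> Cld X. F \<subseteq> U}"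
  unfolding vietoris_def by (rule topology_generated_by_Basis) blast

lemma continuous_map_into_vietoris:
  assumes cld: "\<And>z. z \<in> topspace Z \<Longrightarrow> f z \<in> Cld X"
    and hit: "\<And>U. openin X U \<Longrightarrow> openin Z {z \<in> topspace Z. f z \<inter> U \<noteq> {}}"
    and inside: "\<And>U. openin X U \<Longrightarrow> openin Z {z \<in> topspace Z. f z \<subseteq> U}"
  shows "continuous_map Z (vietoris X) f"
proof -
  let ?B = "{{F \<in> Cld X. F \<inter> U \<noteq> {}} | U. openin X U} \<union>
            {{F \<in> Cld X. F \<subseteq> U} | U. openin X U}"
  have "openin Z (f -` W \<inter> topspace Z)" if W: "W \<in> ?B" for W
  proof -
    obtain U where U: "openin X U"
      and "W = {F \<in> Cld X. F \<inter> U \<noteq> {}} \<or> W = {F \<in> Cld X. F \<subseteq> U}"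
      using W by blast
    then have "f -` W \<inter> topspace Z = {z \<in> topspace Z. f z \<inter> U \<noteq> {}} \<or>
               f -` W \<inter> topspace Z = {z \<in> topspace Z. f z \<subseteq> U}"
      using cld by blast
    then show ?thesis
      using hit[OF U] inside[OF U] by (elim disjE) simp_all
  qed
  moreover have "f ` topspace Z \<subseteq> \<Union>?B"
    using cld topspace_vietoris[of X]
    unfolding vietoris_def topology_generated_by_topspace by blast
  ultimately show ?thesis
    unfolding vietoris_def by (rule continuous_on_generated_topo)
qed

section \<open>Compact spaces with a tie-breaking distance\<close>

text \<open>
  A compact space \<open>X\<close> with a continuous function \<open>D\<close> that vanishes on the diagonal and is
  positive off it. Symmetry and the triangle inequality are not needed. The last
  assumption is the abstract form of strict convexity: near any \<open>x\<close> there is a point \<open>y\<close>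
  that is strictly closer to \<open>p\<close> than to every other point \<open>q\<close> for which \<open>x\<close> itself was at
  least as close to \<open>p\<close> as to \<open>q\<close>. One \<open>y\<close> has to serve all \<open>q\<close> at once.
\<close>
locale approach_gauge =
  fixes X :: "'a topology" and D :: "'a \<Rightarrow> 'a \<Rightarrow> real"
  assumes compact: "compact_space X"
    and cont: "continuous_map (prod_topology X X) euclideanreal (\<lambda>(x, y). D x y)"
    and self [simp]: "D x x = 0"
    and pos: "\<lbrakk>x \<in> topspace X; y \<in> topspace X; x \<noteq> y\<rbrakk> \<Longrightarrow> 0 < D x y"
    and approach: "\<lbrakk>x \<in> topspace X; p \<in> topspace X; openin X U; x \<in> U\<rbrakk> \<Longrightarrow>
      \<exists>y\<in>U. \<forall>q\<in>topspace X. q \<noteq> p \<longrightarrow> D x p \<le> D x q \<longrightarrow> D y p < D y q"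
begin

text \<open>The distance from a point to a set, in terms of \<open>D\<close>; meaningful for \<open>A \<in> Cld X\<close>, where the
  infimum is attained.\<close>
definition gap :: "'a \<Rightarrow> 'a set \<Rightarrow> real" where
  "gap x A = (INF a\<in>A. D x a)"

text \<open>The half of \<open>X\<close> that belongs to \<open>A\<close>, including the bisector of \<open>A\<close> and \<open>B\<close>.\<close>
definition near :: "'a set \<Rightarrow> 'a set \<Rightarrow> 'a set" where
  "near A B = {x \<in> topspace X. gap x A \<le> gap x B}"

lemma Cld_compactin: "A \<in> Cld X \<Longrightarrow> compactin X A"
  using compact closedin_compact_space by (auto simp: Cld_def)

lemma Cld_subset: "A \<in> Cld X \<Longrightarrow> A \<subseteq> topspace X"
  by (auto simp: Cld_def dest: closedin_subset)

lemma cont_right: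
  assumes "x \<in> topspace X"
  shows "continuous_map X euclideanreal (D x)"
proof -
  have "continuous_map X (prod_topology X X) (\<lambda>y. (x, y))"
    using assms by (simp add: continuous_map_pairedI)
  from continuous_map_compose[OF this cont] show ?thesis
    by (simp add: o_def)
qed

lemma gap_attained:
  assumes "x \<in> topspace X" "A \<in> Cld X"
  obtains a where "a \<in> A" "gap x A = D x a" "\<And>b. b \<in> A \<Longrightarrow> D x a \<le> D x b"
proof -
  have "compact (D x ` A)"
    using image_compactin[OF Cld_compactin[OF assms(2)] cont_right[OF assms(1)]] by simp
  moreover have "D x ` A \<noteq> {}"
    using assms by (auto simp: Cld_def)
  ultimately obtain a where a: "a \<in> A" "\<And>b. b \<in> A \<Longrightarrow> D x a \<le> D x b"
    using compact_attains_inf by (metis (no_types, lifting) imageE imageI)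
  moreover from a have "gap x A = D x a"
    unfolding gap_def by (intro cInf_eq_minimum) auto
  ultimately show thesis using that by blast
qed

lemma gap_le:
  assumes "x \<in> topspace X" "A \<in> Cld X" "a \<in> A"
  shows "gap x A \<le> D x a"
  using gap_attained[OF assms(1,2)] assms(3) by metis

lemma gap_less_iff:
  assumes "x \<in> topspace X" "A \<in> Cld X"
  shows "gap x A < c \<longleftrightarrow> (\<exists>a\<in>A. D x a < c)"
  using gap_attained[OF assms] by (metis le_less_trans)

lemma gap_greater_iff:
  assumes "x \<in> topspace X" "A \<in> Cld X"
  shows "c < gap x A \<longleftrightarrow> (\<forall>a\<in>A. c < D x a)"
  using gap_attained[OF assms] by (metis less_le_trans)

lemma gap_self:
  assumes "A \<in> Cld X" "a \<in> A"
  shows "gap a A \<le> 0"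
  using gap_le[of a A a] assms Cld_subset by auto

lemma gap_pos:
  assumes "x \<in> topspace X" "A \<in> Cld X" "x \<notin> A"
  shows "0 < gap x A"
proof -
  have "0 < D x a" if "a \<in> A" for a
    using that assms Cld_subset[of A] by (intro pos) auto
  then show ?thesis
    using gap_greater_iff assms by simp
qed

text \<open>The condition \<open>c < gap x A\<close> says that \<open>{x} \<times> A\<close> lies in an open set, and is open by
  Wallace's theorem and the sets \<open>U\<^sup>+\<close>; the condition \<open>gap x A < c\<close> says that \<open>{x} \<times> A\<close> meets
  an open set, and is open by the sets \<open>U\<^sup>-\<close>.\<close>
lemma gap_continuous:
  "continuous_map (prod_topology X (vietoris X)) euclideanreal (\<lambda>(x, A). gap x A)"
proof -
  let ?P = "prod_topology X (vietoris X)"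
  have "openin ?P {z \<in> topspace ?P. c < (\<lambda>(x, A). gap x A) z}" for c
    unfolding openin_prod_topology_alt
  proof clarify
    fix x A assume "(x, A) \<in> topspace ?P" "c < gap x A"
    then have x: "x \<in> topspace X" and A: "A \<in> Cld X" by auto
    let ?W = "{w \<in> topspace (prod_topology X X). (\<lambda>(x, y). D x y) w \<in> {c<..}}"
    have W: "openin (prod_topology X X) ?W"
      by (rule openin_continuous_map_preimage[OF cont]) auto
    have sub0: "{x} \<times> A \<subseteq> ?W"
      using \<open>c < gap x A\<close> x A Cld_subset[OF A] by (auto simp: gap_greater_iff)
    have "compactin X {x}"
      using x by simp
    from Wallace_theorem_prod_topology[OF this Cld_compactin[OF A] W sub0]
    obtain U V where UV: "openin X U" "openin X V" "{x} \<subseteq> U" "A \<subseteq> V" "U \<times> V \<subseteq> ?W" .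
    have sub: "U \<times> {F \<in> Cld X. F \<subseteq> V} \<subseteq> {z \<in> topspace ?P. c < (\<lambda>(x, A). gap x A) z}"
    proof clarify
      fix u F assume u: "u \<in> U" and F: "F \<in> Cld X" "F \<subseteq> V"
      have "c < D u a" if "a \<in> V" for a
        using subsetD[OF UV(5), of "(u, a)"] u that by simp
      then have "u \<in> topspace X" "\<forall>a\<in>F. c < D u a"
        using u F openin_subset[OF UV(1)] by auto
      then show "(u, F) \<in> topspace ?P \<and> c < gap u F"
        using F by (simp add: gap_greater_iff)
    qed
    show "\<exists>U V. openin X U \<and> openin (vietoris X) V \<and> x \<in> U \<and> A \<in> V \<and>
            U \<times> V \<subseteq> {z \<in> topspace ?P. c < (case z of (x, A) \<Rightarrow> gap x A)}"
      using UV A sub vietoris_inside_open[OF UV(2)]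
      by (intro exI[of _ U] exI[of _ "{F \<in> Cld X. F \<subseteq> V}"]) auto
  qed
  moreover have "openin ?P {z \<in> topspace ?P. (\<lambda>(x, A). gap x A) z < c}" for c
    unfolding openin_prod_topology_alt
  proof clarify
    fix x A assume "(x, A) \<in> topspace ?P" "gap x A < c"
    then have x: "x \<in> topspace X" and A: "A \<in> Cld X" by auto
    let ?W = "{w \<in> topspace (prod_topology X X). (\<lambda>(x, y). D x y) w \<in> {..<c}}"
    have W: "openin (prod_topology X X) ?W"
      by (rule openin_continuous_map_preimage[OF cont]) auto
    obtain a where a: "a \<in> A" "D x a < c"
      using \<open>gap x A < c\<close> x A by (auto simp: gap_less_iff)
    then have "(x, a) \<in> ?W"
      using x Cld_subset[OF A] by auto
    from W[unfolded openin_prod_topology_alt, rule_format, OF this]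
    obtain U V where UV: "openin X U" "openin X V" "x \<in> U" "a \<in> V" "U \<times> V \<subseteq> ?W"
      by (elim exE conjE)
    have sub: "U \<times> {F \<in> Cld X. F \<inter> V \<noteq> {}} \<subseteq> {z \<in> topspace ?P. (\<lambda>(x, A). gap x A) z < c}"
    proof clarify
      fix u F assume u: "u \<in> U" and F: "F \<in> Cld X" "F \<inter> V \<noteq> {}"
      have "D u a < c" if "a \<in> V" for a
        using subsetD[OF UV(5), of "(u, a)"] u that by simp
      then have "u \<in> topspace X" "\<exists>a\<in>F. D u a < c"
        using u F openin_subset[OF UV(1)] by auto
      then show "(u, F) \<in> topspace ?P \<and> gap u F < c"
        using F by (simp add: gap_less_iff)
    qed
    show "\<exists>U V. openin X U \<and> openin (vietoris X) V \<and> x \<in> U \<and> A \<in> V \<and>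
            U \<times> V \<subseteq> {z \<in> topspace ?P. (case z of (x, A) \<Rightarrow> gap x A) < c}"
      using UV A a sub vietoris_hit_open[OF UV(2)]
      by (intro exI[of _ U] exI[of _ "{F \<in> Cld X. F \<inter> V \<noteq> {}}"]) auto
  qed
  ultimately show ?thesis
    unfolding continuous_map_upper_lower_semicontinuous_lt by blast
qed

lemma near_superset:
  assumes "A \<in> Cld X" "B \<in> Cld X" "A \<inter> B = {}"
  shows "A \<subseteq> near A B"
proof
  fix a assume a: "a \<in> A"
  then have "a \<in> topspace X" "a \<notin> B"
    using assms Cld_subset by auto
  then show "a \<in> near A B"
    using gap_self[OF assms(1) a] gap_pos[of a B] assms(2) by (simp add: near_def)
qed

lemma near_disjoint:
  assumes "A \<in> Cld X" "B \<in> Cld X" "A \<inter> B = {}"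
  shows "B \<inter> near A B = {}"
proof -
  have "gap b B < gap b A" if "b \<in> B" for b
    using gap_self[OF assms(2) that] gap_pos[of b A] assms that Cld_subset[of B] by force
  then show ?thesis by (force simp: near_def)
qed

lemma near_cover: "near A B \<union> near B A = topspace X"
  by (auto simp: near_def)

text \<open>This is the only use of the \<open>approach\<close> assumption. Without it the bisector can have
  interior points, or be a local maximum of \<open>gap y B - gap y A\<close>, and \<open>near\<close> can fail to
  be lower semicontinuous.\<close>
lemma near_hits_open_iff:
  assumes A: "A \<in> Cld X" and B: "B \<in> Cld X" and disj: "A \<inter> B = {}" and U: "openin X U"
  shows "near A B \<inter> U \<noteq> {} \<longleftrightarrow> (\<exists>y\<in>U. gap y A < gap y B)"
proof
  assume "near A B \<inter> U \<noteq> {}"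
  then obtain x where x: "x \<in> topspace X" "gap x A \<le> gap x B" "x \<in> U"
    by (auto simp: near_def)
  obtain a where a: "a \<in> A" "gap x A = D x a"
    using gap_attained[OF x(1) A] by metis
  obtain y where y: "y \<in> U"
    "\<And>q. q \<in> topspace X \<Longrightarrow> q \<noteq> a \<Longrightarrow> D x a \<le> D x q \<Longrightarrow> D y a < D y q"
    using approach[OF x(1) _ U x(3), of a] a Cld_subset[OF A] by blast
  have yX: "y \<in> topspace X"
    using y U openin_subset by blast
  have "D y a < D y q" if "q \<in> B" for q
    using that a x(2) disj gap_le[OF x(1) B that] Cld_subset[OF B] by (intro y(2)) auto
  then have "D y a < gap y B"
    using gap_greater_iff[OF yX B] by blast
  then show "\<exists>y\<in>U. gap y A < gap y B"
    using y(1) gap_le[OF yX A a(1)] by force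
next
  assume "\<exists>y\<in>U. gap y A < gap y B"
  then show "near A B \<inter> U \<noteq> {}"
    using openin_subset[OF U] by (force simp: near_def)
qed

text \<open>Stated for closed sets depending on a parameter, so that it applies to both halves.\<close>
lemma near_continuous:
  assumes \<alpha>: "continuous_map Z (vietoris X) \<alpha>" and \<beta>: "continuous_map Z (vietoris X) \<beta>"
    and disj: "\<And>z. z \<in> topspace Z \<Longrightarrow> \<alpha> z \<inter> \<beta> z = {}"
  shows "continuous_map Z (vietoris X) (\<lambda>z. near (\<alpha> z) (\<beta> z))"
proof -
  have A: "\<alpha> z \<in> Cld X" and B: "\<beta> z \<in> Cld X" if "z \<in> topspace Z" for z
    using continuous_map_funspace[OF \<alpha>] continuous_map_funspace[OF \<beta>] that by auto
  have gapZ: "continuous_map (prod_topology X Z) euclideanreal (\<lambda>(x, z). gap x (\<gamma> z))"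
    if "continuous_map Z (vietoris X) \<gamma>" for \<gamma>
  proof -
    have "continuous_map (prod_topology X Z) (prod_topology X (vietoris X)) (\<lambda>w. (fst w, \<gamma> (snd w)))"
      using that continuous_map_fst continuous_map_compose[OF continuous_map_snd that]
      by (intro continuous_map_pairedI) (auto simp: o_def)
    from continuous_map_compose[OF this gap_continuous] show ?thesis
      by (simp add: o_def case_prod_unfold)
  qed
  define h where "h = (\<lambda>(x, z). gap x (\<beta> z) - gap x (\<alpha> z))"
  have h: "continuous_map (prod_topology X Z) euclideanreal h"
    using continuous_map_diff[OF gapZ[OF \<beta>] gapZ[OF \<alpha>]] by (simp add: h_def case_prod_unfold)
  have slice_x: "continuous_map X euclideanreal (\<lambda>x. h (x, z))" if "z \<in> topspace Z" for z
  proof -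
    have "continuous_map X (prod_topology X Z) (\<lambda>x. (x, z))"
      using that by (simp add: continuous_map_pairedI)
    from continuous_map_compose[OF this h] show ?thesis by (simp add: o_def)
  qed
  show ?thesis
  proof (rule continuous_map_into_vietoris)
    fix z assume z: "z \<in> topspace Z"
    have "closedin X {x \<in> topspace X. h (x, z) \<in> {0..}}"
      by (rule closedin_continuous_map_preimage[OF slice_x[OF z]]) simp
    moreover have "{x \<in> topspace X. h (x, z) \<in> {0..}} = near (\<alpha> z) (\<beta> z)"
      by (auto simp: near_def h_def)
    ultimately show "near (\<alpha> z) (\<beta> z) \<in> Cld X"
      using near_superset[OF A[OF z] B[OF z] disj[OF z]] A[OF z] by (auto simp: Cld_def)
  next
    fix U assume U: "openin X U"
    \<comment> \<open>The set in question is the projection of an open set, and projections are open.\<close>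
    let ?W = "(U \<times> topspace Z) \<inter> {w \<in> topspace (prod_topology X Z). h w \<in> {0<..}}"
    have "openin (prod_topology X Z) ?W"
      using U by (intro openin_Int openin_continuous_map_preimage[OF h])
        (auto simp: openin_prod_Times_iff)
    then have "openin Z (snd ` ?W)"
      using open_map_snd unfolding open_map_def by blast
    moreover have "snd ` ?W = {z \<in> topspace Z. near (\<alpha> z) (\<beta> z) \<inter> U \<noteq> {}}"
    proof (intro set_eqI)
      fix z
      have "z \<in> snd ` ?W \<longleftrightarrow> z \<in> topspace Z \<and> (\<exists>x\<in>U. gap x (\<alpha> z) < gap x (\<beta> z))"
        using openin_subset[OF U] by (auto simp: h_def image_iff Bex_def)
      then show "z \<in> snd ` ?W \<longleftrightarrow> z \<in> {z \<in> topspace Z. near (\<alpha> z) (\<beta> z) \<inter> U \<noteq> {}}"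
        using near_hits_open_iff[of "\<alpha> z" "\<beta> z" U] A[of z] B[of z] disj[of z] U by blast
    qed
    ultimately show "openin Z {z \<in> topspace Z. near (\<alpha> z) (\<beta> z) \<inter> U \<noteq> {}}" by simp
  next
    fix U assume U: "openin X U"
    \<comment> \<open>The complement is the projection of a closed set along the compact factor \<open>X\<close>.\<close>
    let ?C = "((topspace X - U) \<times> topspace Z) \<inter> {w \<in> topspace (prod_topology X Z). h w \<in> {0..}}"
    have "closedin (prod_topology X Z) ?C"
      using U by (intro closedin_Int closedin_continuous_map_preimage[OF h])
        (auto simp: closedin_prod_Times_iff)
    then have "closedin Z (snd ` ?C)"
      using closed_map_snd[OF compact] unfolding closed_map_def by blast
    then have "openin Z (topspace Z - snd ` ?C)"
      by (rule openin_diff[OF openin_topspace])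
    moreover have "topspace Z - snd ` ?C = {z \<in> topspace Z. near (\<alpha> z) (\<beta> z) \<subseteq> U}"
      by (force simp: near_def h_def image_iff)
    ultimately show "openin Z {z \<in> topspace Z. near (\<alpha> z) (\<beta> z) \<subseteq> U}"
      by simp
  qed
qed

theorem CT4_X: "CT4 X"
proof -
  let ?V = "prod_topology (vietoris X) (vietoris X)"
  let ?T = "subtopology ?V (T4_pairs X)"
  define \<phi> where "\<phi> = (\<lambda>P. (near (snd P) (fst P), near (fst P) (snd P)))"
  have "continuous_map ?T (vietoris X) fst" "continuous_map ?T (vietoris X) snd"
    by (simp_all add: continuous_map_from_subtopology continuous_map_fst continuous_map_snd)
  then have "continuous_map ?T ?V \<phi>"
    unfolding \<phi>_def by (intro continuous_map_pairedI near_continuous) (auto simp: T4_pairs_def)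
  moreover have "fst (\<phi> (F1, F2)) \<union> snd (\<phi> (F1, F2)) = topspace X \<and>
      F1 \<inter> fst (\<phi> (F1, F2)) = {} \<and> F2 \<inter> snd (\<phi> (F1, F2)) = {}"
    if "(F1, F2) \<in> T4_pairs X" for F1 F2
    using that near_cover near_disjoint[of F1 F2] near_disjoint[of F2 F1]
    by (auto simp: \<phi>_def T4_pairs_def Int_commute)
  ultimately show ?thesis
    unfolding CT4_def by blast
qed

end

section \<open>The squared Hilbert distance on the cube\<close>

text \<open>
  The sum runs over all of \<open>nat\<close>, whatever the dimension: off the index set, all points of
  the cube take the value \<open>undefined\<close>, so the terms there vanish. Squared distances are used
  rather than distances since they compare in the same way and make
  \<open>cube_sqdist_affine\<close> an identity between coordinates.
\<close>
definition cube_sqdist :: "(nat \<Rightarrow> real) \<Rightarrow> (nat \<Rightarrow> real) \<Rightarrow> real" where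
  "cube_sqdist x y = (\<Sum>i. (1/2)^i * (x i - y i)^2)"

lemma topspace_cube: "topspace (cube n) = (\<Pi>\<^sub>E i\<in>{i. enat i < n}. {0..1})"
  by (simp add: cube_def)

lemma cube_coord_diff:
  assumes "x \<in> topspace (cube n)" "y \<in> topspace (cube n)"
  shows "(x i - y i)^2 \<le> 1"
proof -
  have "x i - y i = 0 \<or> x i \<in> {0..1} \<and> y i \<in> {0..1}"
    using assms unfolding topspace_cube
    by (cases "enat i < n") (auto simp: PiE_iff extensional_def)
  then have "\<bar>x i - y i\<bar> \<le> 1" by auto
  then show ?thesis by (simp add: abs_square_le_1)
qed

lemma cube_summable:
  assumes "x \<in> topspace (cube n)" "y \<in> topspace (cube n)"
  shows "summable (\<lambda>i. (1/2)^i * (x i - y i)^2)"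
proof (rule summable_comparison_test')
  show "summable (\<lambda>i. (1/2)^i :: real)" by (simp add: summable_geometric)
  show "norm ((1/2)^i * (x i - y i)^2) \<le> (1/2)^i" if "0 \<le> i" for i
    using cube_coord_diff[OF assms, of i] by (simp add: mult_left_le)
qed

lemma cube_sqdist_continuous:
  "continuous_map (prod_topology (cube n) (cube n)) euclideanreal (\<lambda>(x, y). cube_sqdist x y)"
proof -
  let ?P = "prod_topology (cube n) (cube n)"
  let ?f = "\<lambda>N w. \<Sum>i<N. (1/2)^i * (fst w i - snd w i)^2 :: real"
  have unif: "uniform_limit (topspace ?P) ?f (\<lambda>w. cube_sqdist (fst w) (snd w)) sequentially"
    unfolding cube_sqdist_def
  proof (rule Weierstrass_m_test)
    show "summable (\<lambda>i. (1/2)^i :: real)" by (simp add: summable_geometric)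
    show "norm ((1/2)^i * (fst w i - snd w i)^2) \<le> (1/2)^i" if "w \<in> topspace ?P" for i w
      using cube_coord_diff[of "fst w" n "snd w" i] that
      by (auto simp: mult_left_le)
  qed
  have coord: "continuous_map (cube n) euclideanreal (\<lambda>x. x i)" for i
  proof (cases "enat i < n")
    case True
    then have "continuous_map (cube n) (top_of_set {0..1::real}) (\<lambda>x. x i)"
      unfolding cube_def by (intro continuous_map_product_projection) simp
    then show ?thesis by (simp add: continuous_map_in_subtopology)
  next
    case False
    have "continuous_map (cube n) euclideanreal (\<lambda>x. undefined)" by simp
    then show ?thesis
      by (rule continuous_map_eq) (use False in \<open>auto simp: topspace_cube PiE_iff extensional_def\<close>)
  qed
  have c1: "continuous_map ?P euclideanreal (\<lambda>w. fst w i)"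
   and c2: "continuous_map ?P euclideanreal (\<lambda>w. snd w i)" for i
    using continuous_map_compose[OF continuous_map_fst coord]
      continuous_map_compose[OF continuous_map_snd coord] by (auto simp: o_def)
  have f: "continuous_map ?P euclideanreal (?f N)" for N
    by (intro continuous_map_sum continuous_map_real_mult continuous_map_real_pow
        continuous_map_diff c1 c2) auto
  have "continuous_map ?P (Met_TC.mtopology) (\<lambda>w. cube_sqdist (fst w) (snd w))"
  proof (rule Met_TC.continuous_map_uniform_limit)
    show "\<forall>\<^sub>F N in sequentially. continuous_map ?P Met_TC.mtopology (?f N)"
      using f by simp
    show "\<forall>\<^sub>F N in sequentially. \<forall>w\<in>topspace ?P.
        cube_sqdist (fst w) (snd w) \<in> UNIV \<and> dist (?f N w) (cube_sqdist (fst w) (snd w)) < e"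
      if "0 < e" for e
      using uniform_limitD[OF unif that] by simp
  qed simp
  then show ?thesis by (simp add: case_prod_unfold)
qed

lemma cube_sqdist_pos:
  assumes "x \<in> topspace (cube n)" "y \<in> topspace (cube n)" "x \<noteq> y"
  shows "0 < cube_sqdist x y"
proof -
  obtain i where "x i \<noteq> y i" using assms(3) by blast
  then show ?thesis
    unfolding cube_sqdist_def
    by (intro suminf_pos2[OF cube_summable[OF assms(1,2)], of i]) auto
qed

lemma cube_segment:
  assumes "x \<in> topspace (cube n)" "p \<in> topspace (cube n)" "t \<in> {0..1}"
  shows "(\<lambda>i. (1 - t) * x i + t * p i) \<in> topspace (cube n)"
proof -
  have "(1 - t) * x i + t * p i \<in> {0..1}" if "enat i < n" for i
  proof -
    have "x i \<in> {0..1}" "p i \<in> {0..1}"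
      using assms that by (auto simp: topspace_cube PiE_iff)
    then show ?thesis
      using assms(3) convexD[OF convex_real_interval(5)[of 0 1], of "x i" "p i" "1 - t" t] by simp
  qed
  \<comment> \<open>Off the index set, the combination of \<open>undefined\<close> with itself is again \<open>undefined\<close>.\<close>
  moreover have "(1 - t) * x i + t * p i = undefined" if "\<not> enat i < n" for i
    using assms that by (simp add: topspace_cube PiE_iff extensional_def algebra_simps)
  ultimately show ?thesis
    by (auto simp: topspace_cube PiE_iff extensional_def)
qed

lemma cube_segment_continuous:
  assumes "x \<in> topspace (cube n)" "p \<in> topspace (cube n)"
  shows "continuous_map (top_of_set {0..1}) (cube n) (\<lambda>t i. (1 - t) * x i + t * p i)"
  unfolding cube_def continuous_map_componentwise
proof (intro conjI ballI)
  show "(\<lambda>t i. (1 - t) * x i + t * p i) ` topspace (top_of_set {0..1}) \<subseteq> extensional {i. enat i < n}"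
    using cube_segment[OF assms] by (auto simp: topspace_cube PiE_iff)
next
  fix i assume "i \<in> {i. enat i < n}"
  then have "(\<lambda>t. (1 - t) * x i + t * p i) ` {0..1} \<subseteq> {0..1}"
    using cube_segment[OF assms] by (auto simp: topspace_cube PiE_iff)
  moreover have "continuous_on {0..1} (\<lambda>t. (1 - t) * x i + t * p i)"
    by (intro continuous_intros)
  ultimately show "continuous_map (top_of_set {0..1}) (top_of_set {0..1}) (\<lambda>t. (1 - t) * x i + t * p i)"
    by (simp add: continuous_map_in_subtopology image_subset_iff_funcset)
qed

text \<open>Up to the constant \<open>\<parallel>q\<parallel>\<^sup>2 - \<parallel>p\<parallel>\<^sup>2\<close>, the difference of the squared distances from \<open>y\<close> to
  \<open>q\<close> and to \<open>p\<close> is linear in \<open>y\<close>; it is evaluated here on the segment from \<open>x\<close> to \<open>p\<close>.\<close>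
lemma cube_sqdist_affine:
  assumes x: "x \<in> topspace (cube n)" and p: "p \<in> topspace (cube n)"
    and q: "q \<in> topspace (cube n)" and t: "t \<in> {0..1}"
  defines "y \<equiv> \<lambda>i. (1 - t) * x i + t * p i"
  shows "cube_sqdist y q - cube_sqdist y p =
         (1 - t) * (cube_sqdist x q - cube_sqdist x p) + t * cube_sqdist p q"
proof -
  have y: "y \<in> topspace (cube n)"
    unfolding y_def by (rule cube_segment[OF x p t])
  note sm = cube_summable[where n = n]
  have "cube_sqdist y q - cube_sqdist y p =
      (\<Sum>i. (1/2)^i * (y i - q i)^2 - (1/2)^i * (y i - p i)^2)"
    unfolding cube_sqdist_def by (rule suminf_diff[OF sm[OF y q] sm[OF y p]])
  also have "\<dots> = (\<Sum>i. (1 - t) * ((1/2)^i * (x i - q i)^2 - (1/2)^i * (x i - p i)^2)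
      + t * ((1/2)^i * (p i - q i)^2))"
  proof (rule suminf_cong)
    fix i
    have "(y i - q i)^2 - (y i - p i)^2 =
        (1 - t) * ((x i - q i)^2 - (x i - p i)^2) + t * (p i - q i)^2"
      unfolding y_def by (simp add: power2_eq_square algebra_simps)
    then have "(1/2)^i * ((y i - q i)^2 - (y i - p i)^2) =
        (1/2)^i * ((1 - t) * ((x i - q i)^2 - (x i - p i)^2) + t * (p i - q i)^2)"
      by simp
    then show "(1/2)^i * (y i - q i)^2 - (1/2)^i * (y i - p i)^2 =
        (1 - t) * ((1/2)^i * (x i - q i)^2 - (1/2)^i * (x i - p i)^2) + t * ((1/2)^i * (p i - q i)^2)"
      by (simp only: algebra_simps)
  qed
  also have "\<dots> = (\<Sum>i. (1 - t) * ((1/2)^i * (x i - q i)^2 - (1/2)^i * (x i - p i)^2))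
      + (\<Sum>i. t * ((1/2)^i * (p i - q i)^2))"
    by (intro suminf_add[symmetric] summable_mult summable_diff sm x p q)
  also have "\<dots> = (1 - t) * (cube_sqdist x q - cube_sqdist x p) + t * cube_sqdist p q"
    unfolding cube_sqdist_def suminf_diff[OF sm[OF x q] sm[OF x p]]
    by (subst (1 2) suminf_mult) (intro summable_diff sm x p q refl)+
  finally show ?thesis .
qed

text \<open>Any point at a small positive parameter on the segment from \<open>x\<close> to \<open>p\<close> serves: there, the
  affine function of \<open>cube_sqdist_affine\<close> is a convex combination of a nonnegative and
  a positive number, with positive weight on the latter.\<close>
lemma cube_approach:
  assumes x: "x \<in> topspace (cube n)" and p: "p \<in> topspace (cube n)"
    and U: "openin (cube n) U" "x \<in> U"
  shows "\<exists>y\<in>U. \<forall>q\<in>topspace (cube n). q \<noteq> p \<longrightarrow>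
           cube_sqdist x p \<le> cube_sqdist x q \<longrightarrow> cube_sqdist y p < cube_sqdist y q"
proof -
  let ?y = "\<lambda>t i. (1 - t) * x i + t * p i"
  have "openin (top_of_set {0..1}) {t \<in> topspace (top_of_set {0..1}). ?y t \<in> U}"
    by (rule openin_continuous_map_preimage[OF cube_segment_continuous[OF x p] U(1)])
  moreover have "0 \<in> {t \<in> topspace (top_of_set {0..1}). ?y t \<in> U}"
    using U(2) by simp
  ultimately obtain e :: real where "0 < e"
    and e: "\<And>t. t \<in> {0..1} \<Longrightarrow> dist t 0 < e \<Longrightarrow> ?y t \<in> U"
    unfolding openin_euclidean_subtopology_iff by force
  \<comment> \<open>The same parameter works for all \<open>q\<close>, as it depends only on \<open>U\<close>.\<close>
  define t where "t = min 1 (e/2)"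
  have t: "t \<in> {0..1}" "0 < t" and "dist t 0 < e"
    using \<open>0 < e\<close> by (auto simp: t_def)
  have "cube_sqdist (?y t) p < cube_sqdist (?y t) q"
    if q: "q \<in> topspace (cube n)" "q \<noteq> p" and le: "cube_sqdist x p \<le> cube_sqdist x q" for q
  proof -
    have "0 \<le> (1 - t) * (cube_sqdist x q - cube_sqdist x p)"
      using t le by auto
    moreover have "0 < t * cube_sqdist p q"
      using t cube_sqdist_pos[OF p q(1)] q(2) by auto
    ultimately show ?thesis
      using cube_sqdist_affine[OF x p q(1) t(1)] by linarith
  qed
  then show ?thesis
    using e[OF t(1) \<open>dist t 0 < e\<close>] by blast
qed

theorem mainTheorem8:
  fixes n :: enat
  assumes "1 \<le> n"
  shows "CT4 (cube n)"
proof -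
  interpret approach_gauge "cube n" cube_sqdist
  proof
    show "compact_space (cube n)"
      unfolding cube_def by (simp add: compact_space_product_topology compact_space_subtopology)
    show "continuous_map (prod_topology (cube n) (cube n)) euclideanreal (\<lambda>(x, y). cube_sqdist x y)"
      by (rule cube_sqdist_continuous)
    show "cube_sqdist x x = 0" for x
      by (simp add: cube_sqdist_def)
  qed (use cube_sqdist_pos cube_approach in auto)
  show ?thesis by (rule CT4_X)
qed

end
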